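(* Let $\mathbb{V}$ be a finite dimensional vector space over a field $\mathbb{F}$ with $\dim(\mathbb{V})>1$. Then the subspace sum graph $\mathcal{G}(\mathbb{V})$ is triangulated, and hence $\operatorname{girth}(\mathcal{G}(\mathbb{V}))=3$.
   Context: For a finite dimensional vector space $\mathbb{V}$ over a field $\mathbb{F}$ with $\dim(\mathbb{V})>1$, the subspace sum graph $\mathcal{G}(\mathbb{V})$ is the graph whose vertices are the non-trivial proper subspaces of $\mathbb{V}$ (subspaces $W$ with $W\neq\{0\}$ and $W\neq\mathbb{V}$), two vertices $W_1,W_2$ being adjacent if and only if $W_1+W_2=\mathbb{V}$. A graph is triangulated if for every vertex $u$ there exist vertices $v,w$ such that $u,v,w$ form a triangle (a cycle of length 3). The girth is the length of a shortest cycle ($\infty$ if there is none). *)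

theory Defs
  imports
    Complex_Main
    "HOL-Library.Extended_Nat"
    "HOL-Library.Set_Algebras"
    "Graph_Theory.Graph_Theory"
begin

text \<open>
  An undirected simple graph is a symmetric loopfree digraph without parallel arcs
  (\<^locale>\<open>pair_bidirected_digraph\<close>); no finiteness is imposed, because the subspace sum graph
  over an infinite field is infinite.

  In such a digraph \<^const>\<open>pre_digraph.cycle\<close> also accepts the back-and-forth walk u, v, u along a
  single edge, which is not a cycle of the undirected graph. All longer cycles are genuine, so
  requiring length at least 3 gives exactly the undirected cycles.
\<close>

definition undirected_cycle :: "'a pair_pre_digraph \<Rightarrow> ('a \<times> 'a) awalk \<Rightarrow> bool" where
  "undirected_cycle G p \<longleftrightarrow> pre_digraph.cycle (with_proj G) p \<and> 3 \<le> length p"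

definition forms_triangle :: "'a pair_pre_digraph \<Rightarrow> 'a \<Rightarrow> 'a \<Rightarrow> 'a \<Rightarrow> bool" where
  "forms_triangle G u v w \<longleftrightarrow> undirected_cycle G [(u, v), (v, w), (w, u)]"

definition triangulated :: "'a pair_pre_digraph \<Rightarrow> bool" where
  "triangulated G \<longleftrightarrow>
     (\<forall>u \<in> pverts G. \<exists>v \<in> pverts G. \<exists>w \<in> pverts G. forms_triangle G u v w)"

text \<open>The infimum of the empty set in \<^typ>\<open>enat\<close> is infinity, the girth of an acyclic graph.\<close>

definition girth :: "'a pair_pre_digraph \<Rightarrow> enat" where
  "girth G = (INF p \<in> {p. undirected_cycle G p}. enat (length p))"

text \<open>
  The vector space is the whole type \<^typ>\<open>'v\<close>, with scalar multiplication \<open>scale\<close>. The sum of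
  two subspaces is the elementwise sum of sets from \<^theory>\<open>HOL-Library.Set_Algebras\<close>.
\<close>

definition nontrivial_proper_subspaces ::
    "('f::field \<Rightarrow> 'v::ab_group_add \<Rightarrow> 'v) \<Rightarrow> 'v set set" where
  "nontrivial_proper_subspaces scale = {W. module.subspace scale W \<and> W \<noteq> {0} \<and> W \<noteq> UNIV}"

definition subspace_sum_graph ::
    "('f::field \<Rightarrow> 'v::ab_group_add \<Rightarrow> 'v) \<Rightarrow> 'v set pair_pre_digraph" where
  "subspace_sum_graph scale =
     \<lparr> pverts = nontrivial_proper_subspaces scale,
       parcs = {(W\<^sub>1, W\<^sub>2). W\<^sub>1 \<in> nontrivial_proper_subspaces scale
                  \<and> W\<^sub>2 \<in> nontrivial_proper_subspaces scale \<and> W\<^sub>1 + W\<^sub>2 = UNIV} \<rparr>"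

lemma (in module) subspace_plus_self:
  assumes W: "subspace W"
  shows "W + W = W"
proof
  show "W + W \<subseteq> W"
    using W by (auto elim!: set_plus_elim intro: subspace_add)
  show "W \<subseteq> W + W"
    using W set_plus_intro[of _ W 0 W] by (fastforce simp: subspace_0)
qed

text \<open>Loops are excluded without further ado, since a proper subspace satisfies \<open>W + W = W\<close>.\<close>

lemma pair_bidirected_digraph_subspace_sum_graph:
  assumes "vector_space scale"
  shows "pair_bidirected_digraph (subspace_sum_graph scale)"
proof -
  interpret vector_space scale by fact
  show ?thesis
  proof
    fix e assume e: "e \<in> parcs (subspace_sum_graph scale)"
    show "fst e \<in> pverts (subspace_sum_graph scale)" "snd e \<in> pverts (subspace_sum_graph scale)"
      using e by (auto simp: subspace_sum_graph_def)
    show "fst e \<noteq> snd e"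
      using e subspace_plus_self
      by (auto simp: subspace_sum_graph_def nontrivial_proper_subspaces_def)
  next
    show "symmetric (with_proj (subspace_sum_graph scale))"
      by (auto simp: symmetric_def sym_def subspace_sum_graph_def add.commute)
  qed
qed

end

theory Submission
  imports Defs
begin

text \<open>
  Two distinct hyperplanes sum to the whole space, and so do a hyperplane and any subspace that it
  does not contain. So a vertex \<open>W\<close> lies in a triangle as soon as two distinct hyperplanes do not
  contain it. To find these, take \<open>w \<in> W\<close> nonzero and \<open>c \<notin> W\<close>. Being independent, \<open>w\<close> and \<open>c\<close> can
  be given any values by a linear functional. Let \<open>f w = 1\<close>, \<open>f c = 0\<close> and \<open>g w = g c = 1\<close>: the
  kernels of \<open>f\<close> and \<open>g\<close> both miss \<open>w\<close>, and only the first contains \<open>c\<close>. This works over every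
  field, even with two elements.

  Since the dimension exceeds 1, the line through a nonzero vector is a vertex; the triangle through
  it shows that the girth is at most 3, and no cycle of a simple graph is shorter.
\<close>

lemma (in pair_bidirected_digraph) forms_triangleI:
  assumes "(u, v) \<in> parcs G" "(v, w) \<in> parcs G" "(u, w) \<in> parcs G"
  shows "forms_triangle G u v w"
proof -
  have "(w, u) \<in> parcs G"
    using assms(3) arcs_symmetric by blast
  moreover have "u \<noteq> v" "v \<noteq> w" "u \<noteq> w"
    using assms no_loops by fastforce+
  ultimately show ?thesis
    using assms in_arcsD1
    by (auto simp: forms_triangle_def undirected_cycle_def pre_digraph.cycle_def
        pre_digraph.awalk_def pre_digraph.cas.simps pre_digraph.awalk_verts.simps)
qed

lemma girth_triangulated:
  assumes "triangulated G" "pverts G \<noteq> {}"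
  shows "girth G = 3"
proof (rule antisym)
  obtain u v w where t: "undirected_cycle G [(u, v), (v, w), (w, u)]"
    using assms unfolding triangulated_def forms_triangle_def by blast
  have "girth G \<le> enat (length [(u, v), (v, w), (w, u)])"
    unfolding girth_def using t by (intro INF_lower) simp
  then show "girth G \<le> 3"
    by (simp add: numeral_eq_enat numeral_3_eq_3)
  show "3 \<le> girth G"
    by (auto simp: girth_def undirected_cycle_def numeral_eq_enat intro!: INF_greatest)
qed

lemma linear_functional_on_independent_pair:
  fixes scale :: "'f::field \<Rightarrow> 'v::ab_group_add \<Rightarrow> 'v"
  assumes "vector_space scale" "module.subspace scale W" "w \<in> W" "w \<noteq> 0" "c \<notin> W"
  obtains f where "Vector_Spaces.linear scale (*) f" "f w = a" "f c = b"
proof -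
  interpret vector_space scale by fact
  interpret F: vector_space "(*) :: 'f \<Rightarrow> 'f \<Rightarrow> 'f"
    by unfold_locales (auto simp: algebra_simps)
  interpret vector_space_pair scale "(*) :: 'f \<Rightarrow> 'f \<Rightarrow> 'f" ..
  have "c \<notin> span {w}"
    using span_minimal[of "{w}" W] assms by auto
  then have "independent {c, w}"
    using \<open>w \<noteq> 0\<close> by (simp add: independent_insertI)
  then obtain f where "Vector_Spaces.linear scale (*) f"
      "\<forall>x\<in>{c, w}. f x = (if x = w then a else b)"
    using linear_independent_extend[of "{c, w}" "\<lambda>x. if x = w then a else b"] by blast
  with that show thesis
    using assms by (metis insertCI)
qed

lemma subspace_kernel_functional:
  assumes "Vector_Spaces.linear scale (*) f"
  shows "module.subspace scale {x. f x = 0}"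
proof -
  interpret Vector_Spaces.linear scale "(*)" f by fact
  show ?thesis by (rule subspace_kernel)
qed

text \<open>The projection onto the kernel of \<open>f\<close> along \<open>a\<close> splits off a multiple of \<open>a\<close>.\<close>

lemma subspace_plus_kernel:
  assumes "Vector_Spaces.linear scale (*) f" "module.subspace scale W" "a \<in> W" "f a = 1"
  shows "W + {x. f x = 0} = UNIV"
proof -
  interpret Vector_Spaces.linear scale "(*)" f by fact
  have "x \<in> W + {x. f x = 0}" for x
  proof -
    have "scale (f x) a \<in> W"
      using assms by (simp add: vs1.subspace_scale)
    moreover have "f (x - scale (f x) a) = 0"
      using assms by (simp add: diff scale)
    ultimately show ?thesis
      using set_plus_intro[of "scale (f x) a" W "x - scale (f x) a" "{x. f x = 0}"] by simp
  qed
  then show ?thesis by auto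
qed

lemma triangulated_subspace_sum_graph:
  fixes scale :: "'f::field \<Rightarrow> 'v::ab_group_add \<Rightarrow> 'v"
  assumes vs: "vector_space scale"
  shows "triangulated (subspace_sum_graph scale)"
  unfolding triangulated_def
proof
  interpret vector_space scale by fact
  interpret G: pair_bidirected_digraph "subspace_sum_graph scale"
    by (rule pair_bidirected_digraph_subspace_sum_graph) fact
  let ?N = "nontrivial_proper_subspaces scale"
  fix W assume "W \<in> pverts (subspace_sum_graph scale)"
  then have W: "W \<in> ?N" "subspace W" "W \<noteq> {0}" "W \<noteq> UNIV"
    by (auto simp: subspace_sum_graph_def nontrivial_proper_subspaces_def)
  obtain w where w: "w \<in> W" "w \<noteq> 0"
    using W subspace_0 by blast
  obtain c where c: "c \<notin> W"
    using W by blast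
  obtain f where f: "Vector_Spaces.linear scale (*) f" "f w = 1" "f c = 0"
    using linear_functional_on_independent_pair[OF vs W(2) w c] .
  obtain g where g: "Vector_Spaces.linear scale (*) g" "g w = 1" "g c = 1"
    using linear_functional_on_independent_pair[OF vs W(2) w c] .
  interpret g_lin: Vector_Spaces.linear scale "(*)" g by (fact g(1))
  let ?H = "{x. f x = 0}" and ?K = "{x. g x = 0}"
  have H: "subspace ?H" and K: "subspace ?K"
    using f g by (simp_all add: subspace_kernel_functional)
  have "c \<noteq> 0" "c \<noteq> w"
    using c w W subspace_0 by auto
  moreover have "g (c - w) = 0"
    using g by (simp add: g_lin.diff)
  \<comment> \<open>The vectors \<open>c\<close> and \<open>c - w\<close> show that the kernels are nonzero; this matters in dimension 2,
    where the hyperplanes are lines.\<close>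
  ultimately have "c \<in> ?H - {0}" "c - w \<in> ?K - {0}"
    using f by auto
  moreover have "w \<notin> ?H" "w \<notin> ?K"
    using f g by auto
  ultimately have N: "?H \<in> ?N" "?K \<in> ?N"
    using H K unfolding nontrivial_proper_subspaces_def by blast+
  have "W + ?H = UNIV" "W + ?K = UNIV" "?H + ?K = UNIV"
    using subspace_plus_kernel[OF f(1) W(2) w(1)] subspace_plus_kernel[OF g(1) W(2) w(1)]
      subspace_plus_kernel[OF g(1) H, of c] f g by auto
  then have "forms_triangle (subspace_sum_graph scale) W ?H ?K"
    using W(1) N by (intro G.forms_triangleI) (auto simp: subspace_sum_graph_def)
  then show "\<exists>v\<in>pverts (subspace_sum_graph scale). \<exists>w\<in>pverts (subspace_sum_graph scale).
      forms_triangle (subspace_sum_graph scale) W v w"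
    using N by (auto simp: subspace_sum_graph_def)
qed

lemma (in vector_space) nontrivial_proper_subspaces_nonempty:
  assumes "dim UNIV > 1"
  shows "nontrivial_proper_subspaces scale \<noteq> {}"
proof -
  have "\<exists>v::'b. v \<noteq> 0"
  proof (rule ccontr)
    assume "\<nexists>v::'b. v \<noteq> 0"
    then have "(UNIV :: 'b set) \<subseteq> span {}" by auto
    from dim_le_card[OF this] assms show False by simp
  qed
  then obtain v :: 'b where v: "v \<noteq> 0" by blast
  have "span {v} \<noteq> UNIV"
    using dim_le_card[of UNIV "{v}"] assms by auto
  moreover have "span {v} \<noteq> {0}"
    using v span_base[of v "{v}"] by auto
  ultimately show ?thesis
    by (auto simp: nontrivial_proper_subspaces_def)
qed

theorem theorem3p3:
  fixes scale :: "'f::field \<Rightarrow> 'v::ab_group_add \<Rightarrow> 'v"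
    and Basis :: "'v set"
  assumes "finite_dimensional_vector_space scale Basis"
    and "vector_space.dim scale (UNIV :: 'v set) > 1"
  shows "triangulated (subspace_sum_graph scale)
       \<and> girth (subspace_sum_graph scale) = 3"
proof -
  interpret finite_dimensional_vector_space scale Basis by fact
  have "triangulated (subspace_sum_graph scale)"
    by (rule triangulated_subspace_sum_graph) unfold_locales
  moreover have "pverts (subspace_sum_graph scale) \<noteq> {}"
    using nontrivial_proper_subspaces_nonempty assms(2) by (simp add: subspace_sum_graph_def)
  ultimately show ?thesis
    using girth_triangulated by blast
qed

end
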